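(* For every integer $n\geq 2$ we have $D_{\mathbb Z_n',\{1\}}(n)=3$.
   Context: $\mathbb Z_n=\mathbb Z/n\mathbb Z$ as a module over itself and $\mathbb Z_n'=\mathbb Z_n\setminus\{0\}$. A subsequence is a non-empty subfamily of terms in the original order. For non-empty $A,B\subseteq\mathbb Z_n$, a sequence $(x_1,\ldots,x_k)$ is an $(A,B)$-weighted zero-sum sequence if there exist $a_i\in A$, $b_i\in B$ with $\sum a_ix_i=0$ and $\sum b_ia_i=0$. $D_{A,B}(n)$ is the least positive $k$ such that every sequence in $\mathbb Z_n$ of length $k$ has an $(A,B)$-weighted zero-sum subsequence. *)

theory Defs
  imports "HOL-Number_Theory.Residues" "HOL-Library.Sublist"
begin

definition weighted_zero_sum :: "int \<Rightarrow> int set \<Rightarrow> int set \<Rightarrow> int list \<Rightarrow> bool" where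
  "weighted_zero_sum n A B xs \<longleftrightarrow>
     (\<exists>a b :: nat \<Rightarrow> int.
        (\<forall>i < length xs. a i \<in> A \<and> b i \<in> B) \<and>
        (\<Oplus>\<^bsub>residue_ring n\<^esub> i \<in> {..<length xs}. a i \<otimes>\<^bsub>residue_ring n\<^esub> xs ! i) = \<zero>\<^bsub>residue_ring n\<^esub> \<and>
        (\<Oplus>\<^bsub>residue_ring n\<^esub> i \<in> {..<length xs}. b i \<otimes>\<^bsub>residue_ring n\<^esub> a i) = \<zero>\<^bsub>residue_ring n\<^esub>)"

(* If no such k existed, the value of LEAST would be unspecified. *)
definition weighted_davenport :: "int set \<Rightarrow> int set \<Rightarrow> int \<Rightarrow> nat" where
  "weighted_davenport A B n =
     (LEAST k. 0 < k \<and>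
        (\<forall>xs. set xs \<subseteq> carrier (residue_ring n) \<and> length xs = k \<longrightarrow>
           (\<exists>ys. ys \<noteq> [] \<and> subseq ys xs \<and> weighted_zero_sum n A B ys)))"

definition nonzero_residues :: "int \<Rightarrow> int set" where
  "nonzero_residues n = carrier (residue_ring n) - {\<zero>\<^bsub>residue_ring n\<^esub>}"

end

theory Submission
  imports Defs
begin

text \<open>Two equal terms \<open>x, x\<close> are balanced by the weights \<open>1, -1\<close>, and three pairwise distinct
  terms \<open>x, y, z\<close> by the nonzero weights \<open>y - z, z - x, x - y\<close>. The sequence \<open>0, 1\<close> shows that
  length 2 does not suffice.\<close>

text \<open>Bridge from the ring sum to an integer sum reduced once at the end, so that weighted
  sums become divisibility statements over the integers.\<close>

lemma (in residues) finsum_res_eq: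
  assumes "finite I" "f \<in> I \<rightarrow> carrier R"
  shows "(\<Oplus>i\<in>I. f i) = (\<Sum>i\<in>I. f i) mod m"
  using assms
proof (induction I rule: finite_induct)
  case empty
  then show ?case by (simp add: res_zero_eq)
next
  case (insert i I)
  then have "(\<Oplus>j\<in>insert i I. f j) = f i \<oplus> (\<Oplus>j\<in>I. f j)"
    by (intro finsum_insert) auto
  with insert show ?case
    by (simp add: res_add_eq mod_add_right_eq)
qed

text \<open>Both sums depend on the weights only modulo \<open>n\<close>, so integers not divisible
  by \<open>n\<close> can replace nonzero residues. This allows negative weights such as differences
  of terms.\<close>

lemma weighted_zero_sum_one_iff:
  fixes n :: int
  assumes "n \<ge> 2"
  shows "weighted_zero_sum n (nonzero_residues n) {\<one>\<^bsub>residue_ring n\<^esub>} xs \<longleftrightarrow>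
    (\<exists>a. (\<forall>i<length xs. \<not> n dvd a i) \<and>
         n dvd (\<Sum>i<length xs. a i * xs ! i) \<and> n dvd (\<Sum>i<length xs. a i))"
    (is "?L \<longleftrightarrow> ?R")
proof -
  interpret residues n "residue_ring n"
    using assms by unfold_locales simp_all
  have fs: "(\<Oplus>\<^bsub>residue_ring n\<^esub> i\<in>{..<k}. f i \<otimes>\<^bsub>residue_ring n\<^esub> g i) = (\<Sum>i<k. f i * g i) mod n"
    for f g :: "nat \<Rightarrow> int" and k
    \<comment> \<open>Multiplication in \<open>residue_ring n\<close> reduces modulo
      \<open>n\<close>, so each product lies in the carrier for arbitrary integer factors.\<close>
    by (subst finsum_res_eq) (auto simp: res_mult_eq mod_in_carrier mod_sum_eq)
  have nz: "c \<in> nonzero_residues n \<longleftrightarrow> 0 < c \<and> c < n" for c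
    by (auto simp: nonzero_residues_def res_carrier_eq res_zero_eq)
  show ?thesis
  proof
    assume ?L
    then obtain a b where ab: "\<forall>i<length xs. a i \<in> nonzero_residues n \<and> b i = 1"
      "n dvd (\<Sum>i<length xs. a i * xs ! i)" "n dvd (\<Sum>i<length xs. b i * a i)"
      unfolding weighted_zero_sum_def fs res_zero_eq res_one_eq by (auto simp: dvd_eq_mod_eq_0)
    have "(\<Sum>i<length xs. b i * a i) = (\<Sum>i<length xs. a i)"
      using ab(1) by (intro sum.cong) auto
    with ab show ?R
      by (intro exI[of _ a]) (auto simp: nz dest: zdvd_not_zless)
  next
    assume ?R
    then obtain a where a: "\<forall>i<length xs. \<not> n dvd a i"
      "n dvd (\<Sum>i<length xs. a i * xs ! i)" "n dvd (\<Sum>i<length xs. a i)"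
      by blast
    have "a i mod n \<in> nonzero_residues n" if "i < length xs" for i
    proof -
      have "a i mod n \<noteq> 0" using a(1) that by (auto simp: dvd_eq_mod_eq_0)
      moreover have "0 \<le> a i mod n" "a i mod n < n" using assms by auto
      ultimately show ?thesis unfolding nz by linarith
    qed
    moreover have "(\<Sum>i<length xs. (a i mod n) * xs ! i) mod n = 0"
      using a(2) by (subst mod_sum_eq[symmetric]) (simp add: mod_mult_left_eq mod_sum_eq)
    moreover have "(\<Sum>i<length xs. 1 * (a i mod n)) mod n = 0"
      using a(3) by (simp add: mod_sum_eq)
    ultimately show ?L
      unfolding weighted_zero_sum_def fs res_zero_eq res_one_eq
      by (intro exI[of _ "\<lambda>i. a i mod n"] exI[of _ "\<lambda>_. 1"]) auto
  qed
qed

lemma weighted_zero_sum_pair_eq: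
  fixes n x :: int
  assumes "n \<ge> 2"
  shows "weighted_zero_sum n (nonzero_residues n) {\<one>\<^bsub>residue_ring n\<^esub>} [x, x]"
  unfolding weighted_zero_sum_one_iff[OF assms] using assms
  \<comment> \<open>Both sums vanish already over the integers, and \<open>n \<ge> 2\<close> keeps
    \<open>1\<close> and \<open>- 1\<close> nonzero modulo \<open>n\<close>.\<close>
  by (intro exI[of _ "\<lambda>i. if i = 0 then 1 else - 1"])
     (auto simp: zdvd1_eq)

text \<open>The weights form the cross product of \<open>(x, y, z)\<close> and
  \<open>(1, 1, 1)\<close>, which is orthogonal to both vectors over the integers.\<close>

lemma weighted_zero_sum_triple_distinct:
  fixes n x y z :: int
  assumes "n \<ge> 2" "\<not> n dvd y - z" "\<not> n dvd z - x" "\<not> n dvd x - y"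
  shows "weighted_zero_sum n (nonzero_residues n) {\<one>\<^bsub>residue_ring n\<^esub>} [x, y, z]"
  unfolding weighted_zero_sum_one_iff[OF assms(1)] using assms
  by (intro exI[of _ "(!) [y - z, z - x, x - y]"])
     (auto simp: less_Suc_eq numeral_3_eq_3 algebra_simps)

text \<open>For a single term the sum of the weights is its one weight, and for
  \<open>[0, 1]\<close> the weighted sum is the weight of \<open>1\<close>; neither can be divisible
  by \<open>n\<close>.\<close>

lemma not_weighted_zero_sum_subseq_0_1:
  fixes n :: int
  assumes "n \<ge> 2" "ys \<noteq> []" "subseq ys [0, 1]"
  shows "\<not> weighted_zero_sum n (nonzero_residues n) {\<one>\<^bsub>residue_ring n\<^esub>} ys"
proof -
  have "ys \<in> set (subseqs [0, 1])"
    using assms(3) by (simp only: in_set_subseqs)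
  with assms(2) have "ys = [0] \<or> ys = [1] \<or> ys = [0, 1]"
    by (auto simp: Let_def)
  then show ?thesis
    unfolding weighted_zero_sum_one_iff[OF assms(1)] by auto
qed

lemma exists_weighted_zero_sum_subseq:
  fixes n :: int
  assumes n: "n \<ge> 2" and xs: "set xs \<subseteq> carrier (residue_ring n)" "length xs = 3"
  shows "\<exists>ys. ys \<noteq> [] \<and> subseq ys xs \<and>
    weighted_zero_sum n (nonzero_residues n) {\<one>\<^bsub>residue_ring n\<^esub>} ys"
proof -
  obtain x y z where xyz: "xs = [x, y, z]"
    using xs(2) by (auto simp: numeral_3_eq_3 length_Suc_conv)
  \<comment> \<open>Terms are representatives in \<open>[0, n)\<close>, so distinct ones are
    incongruent modulo \<open>n\<close>.\<close>
  have ndvd: "\<not> n dvd u - v" if "u \<noteq> v" "u \<in> set xs" "v \<in> set xs" for u v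
  proof -
    have "0 \<le> u" "u < n" "0 \<le> v" "v < n"
      using that xs(1) by (auto simp: residue_ring_def)
    then show ?thesis
      using that(1) by (metis mod_eq_dvd_iff mod_pos_pos_trivial)
  qed
  show ?thesis
  proof (cases "distinct xs")
    case True
    then have "weighted_zero_sum n (nonzero_residues n) {\<one>\<^bsub>residue_ring n\<^esub>} xs"
      unfolding xyz using xyz n by (intro weighted_zero_sum_triple_distinct ndvd) auto
    then show ?thesis
      using xyz by blast
  next
    case False
    \<comment> \<open>\<open>x = y\<close> and \<open>x = z\<close> give the first alternative,
      \<open>y = z\<close> the second.\<close>
    then have "subseq [x, x] xs \<or> subseq [y, y] xs"
      by (auto simp: xyz)
    then show ?thesis
      using weighted_zero_sum_pair_eq[OF n] by blast
  qed
qed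

theorem theorem5:
  fixes n :: int
  assumes "n \<ge> 2"
  shows "weighted_davenport (nonzero_residues n) {\<one>\<^bsub>residue_ring n\<^esub>} n = 3"
  unfolding weighted_davenport_def
proof (rule Least_equality)
  show "0 < (3::nat) \<and> (\<forall>xs. set xs \<subseteq> carrier (residue_ring n) \<and> length xs = 3 \<longrightarrow>
    (\<exists>ys. ys \<noteq> [] \<and> subseq ys xs \<and>
      weighted_zero_sum n (nonzero_residues n) {\<one>\<^bsub>residue_ring n\<^esub>} ys))"
    using exists_weighted_zero_sum_subseq[OF assms] by auto
next
  fix k :: nat
  assume k: "0 < k \<and> (\<forall>xs. set xs \<subseteq> carrier (residue_ring n) \<and> length xs = k \<longrightarrow>
    (\<exists>ys. ys \<noteq> [] \<and> subseq ys xs \<and>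
      weighted_zero_sum n (nonzero_residues n) {\<one>\<^bsub>residue_ring n\<^esub>} ys))"
  show "3 \<le> k"
  proof (rule ccontr)
    assume "\<not> 3 \<le> k"
    \<comment> \<open>A prefix of \<open>[0, 1]\<close> handles all lengths below 3 at once: its
      subsequences are subsequences of \<open>[0, 1]\<close>.\<close>
    define xs :: "int list" where "xs = take k [0, 1]"
    have "subseq xs [0, 1]"
      unfolding xs_def by (intro prefix_imp_subseq take_is_prefix)
    moreover have "length xs = k"
      using \<open>\<not> 3 \<le> k\<close> by (simp add: xs_def)
    moreover have "set xs \<subseteq> carrier (residue_ring n)"
      using assms set_take_subset[of k "[0, 1 :: int]"] by (auto simp: xs_def residue_ring_def)
    ultimately show False
      using k not_weighted_zero_sum_subseq_0_1[OF assms] subseq_order.order_trans by blast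
  qed
qed

end
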